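(* There is no matrix $W\in\mathbb{R}^{6\times n}$ such that $rk_t(W)=3$, $rk_K(W)>3$, every row of $\mathcal P(W)$ contains at least one $0$, $\mathcal P(W)$ has a column with support $\{1,2,3\}$ and a column with support $\{4,5,6\}$, and the support of every other column of $\mathcal P(W)$ contains at least two elements of $\{1,2,3\}$ and at least two elements of $\{4,5,6\}$.
   Context: Tropical rank $rk_t$: largest $r$ such that the matrix has an $r\times r$ submatrix $S$ for which $\min_{\sigma}\sum_i s_{i\sigma(i)}$ is attained by exactly one permutation. Kapranov rank $rk_K(B)$: minimal rank over $\mathbf K$ of a matrix $A\in\mathbf K^{m\times n}$ with $\deg a_{ij}=b_{ij}$, where $\mathbf K$ is the field of formal sums $\sum_{e\in\mathbb{R}}a_et^e$ ($a_e\in\mathbb{C}$) with well-ordered support and $\deg$ is the minimal exponent ($\deg 0=\infty$). The pattern $\mathcal P(A)\in\{0,\infty\}^{m\times n}$ has $(u,v)$ entry $0$ if $a_{uv}=\min_i a_{iv}$ and $\infty$ otherwise; the support of a column of $\mathcal P(A)$ is the set of row indices where it is $0$. *)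

theory Defs
  imports
    Complex_Main
    "HOL-Library.Extended_Real"
    "HOL-Combinatorics.Permutations"
    "Jordan_Normal_Form.DL_Rank"
    "Jordan_Normal_Form.DL_Submatrix"
begin

section \<open>Well-ordered sets of reals\<close>

abbreviation well_ordered :: "real set \<Rightarrow> bool" where
  "well_ordered S \<equiv> wfp_on S (<)"

lemma well_ordered_subset: "well_ordered S \<Longrightarrow> T \<subseteq> S \<Longrightarrow> well_ordered T"
  unfolding wfp_on_iff_ex_minimal by (meson order_trans)

lemma well_ordered_least:
  assumes "well_ordered S" "B \<subseteq> S" "B \<noteq> {}"
  shows "\<exists>z\<in>B. \<forall>y\<in>B. z \<le> y"
  using assms unfolding wfp_on_iff_ex_minimal by (meson not_less)

lemma well_orderedI:
  assumes "\<And>f :: nat \<Rightarrow> real. (\<And>n. f n \<in> S) \<Longrightarrow> (\<And>n. f (Suc n) < f n) \<Longrightarrow> False"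
  shows "well_ordered S"
  unfolding wfp_on_iff_ex_minimal
proof (intro allI impI, rule ccontr)
  fix B assume B: "B \<subseteq> S" "B \<noteq> {}" and no: "\<not> (\<exists>z\<in>B. \<forall>y. y < z \<longrightarrow> y \<notin> B)"
  from B obtain b where b: "b \<in> B" by auto
  have "\<exists>f. \<forall>n::nat. f n \<in> B \<and> f (Suc n) < f n"
    by (rule dependent_nat_choice) (use b no in auto)
  then obtain f where "\<And>n::nat. f n \<in> B \<and> f (Suc n) < f n" by auto
  with B show False by (intro assms[of f]) auto
qed

lemma well_ordered_no_descent:
  assumes "well_ordered S" "\<And>n::nat. f n \<in> S" "\<And>n. f (Suc n) < f n"
  shows False
proof -
  have "range f \<subseteq> S" using assms(2) by auto
  from well_ordered_least[OF assms(1) this] obtain n where "f n \<le> f m" for m by auto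
  with assms(3)[of n] show False using not_less by blast
qed

lemma well_ordered_Un:
  assumes "well_ordered S" "well_ordered T"
  shows "well_ordered (S \<union> T)"
  unfolding wfp_on_iff_ex_minimal
proof (intro allI impI)
  fix B assume B: "B \<subseteq> S \<union> T" "B \<noteq> {}"
  show "\<exists>z\<in>B. \<forall>y. y < z \<longrightarrow> y \<notin> B"
  proof (cases "B \<inter> S = {} \<or> B \<inter> T = {}")
    case True
    then have "B \<subseteq> S \<or> B \<subseteq> T" using B by blast
    then show ?thesis using assms B unfolding wfp_on_iff_ex_minimal by blast
  next
    case False
    obtain s where s: "s \<in> B \<inter> S" "\<And>y. y \<in> B \<inter> S \<Longrightarrow> s \<le> y"
      using False well_ordered_least[OF assms(1), of "B \<inter> S"] by blast
    obtain t where t: "t \<in> B \<inter> T" "\<And>y. y \<in> B \<inter> T \<Longrightarrow> t \<le> y"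
      using False well_ordered_least[OF assms(2), of "B \<inter> T"] by blast
    have "min s t \<in> B" using s t by (auto simp: min_def)
    moreover have "y \<notin> B" if "y < min s t" for y
      using that s(2)[of y] t(2)[of y] B by auto
    ultimately show ?thesis by blast
  qed
qed

lemma well_ordered_finite: "finite S \<Longrightarrow> well_ordered S"
  unfolding wfp_on_iff_ex_minimal
  by (metis finite_subset Min_in Min_le not_less)

lemma well_ordered_sums:
  assumes S: "well_ordered S" and T: "well_ordered T"
  shows "well_ordered {a + b |a b. a \<in> S \<and> b \<in> T}"
proof (rule well_orderedI)
  fix f :: "nat \<Rightarrow> real"
  assume f: "\<And>n. f n \<in> {a + b |a b. a \<in> S \<and> b \<in> T}" and dec: "\<And>n. f (Suc n) < f n"
  have "\<forall>n. \<exists>p. f n = fst p + snd p \<and> fst p \<in> S \<and> snd p \<in> T" using f by force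
  then obtain p where p: "\<And>n. f n = fst (p n) + snd (p n)" "\<And>n. fst (p n) \<in> S" "\<And>n. snd (p n) \<in> T"
    by metis
  obtain g :: "nat \<Rightarrow> nat" where g: "strict_mono g" "monoseq (\<lambda>n. fst (p (g n)))"
    using seq_monosub[of "\<lambda>n. fst (p n)"] by auto
  have fdec: "f (g (Suc n)) < f (g n)" for n
  proof -
    have *: "strict_mono (\<lambda>n. - f n)" using dec by (simp add: strict_mono_Suc_iff)
    have "g n < g (Suc n)" using g(1) by (simp add: strict_mono_Suc_iff)
    from strict_monoD[OF * this] show ?thesis by simp
  qed
  have "\<exists>N. \<forall>n\<ge>N. fst (p (g n)) \<le> fst (p (g (Suc n)))"
    using g(2) unfolding monoseq_Suc
  proof
    assume d: "\<forall>n. fst (p (g (Suc n))) \<le> fst (p (g n))"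
    have "range (\<lambda>n. fst (p (g n))) \<subseteq> S" using p(2) by auto
    from well_ordered_least[OF S this] obtain N where N: "fst (p (g N)) \<le> fst (p (g n))" for n by auto
    have "decseq (\<lambda>n. fst (p (g n)))" using d by (simp add: decseq_Suc_iff)
    then have "fst (p (g n)) \<le> fst (p (g (Suc n)))" if "n \<ge> N" for n
      using decseqD[of "\<lambda>n. fst (p (g n))" N n] that N[of "Suc n"] by simp
    then show ?thesis by auto
  qed auto
  then obtain N where N: "\<And>n. n \<ge> N \<Longrightarrow> fst (p (g n)) \<le> fst (p (g (Suc n)))" by auto
  show False
  proof (rule well_ordered_no_descent[OF T, of "\<lambda>n. snd (p (g (N + n)))"])
    fix n
    show "snd (p (g (N + Suc n))) < snd (p (g (N + n)))"
      using N[of "N + n"] fdec[of "N + n"] p(1)[of "g (N + n)"] p(1)[of "g (Suc (N + n))"] by simp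
  qed (rule p(3))
qed

lemma finite_decompositions:
  assumes S: "well_ordered S" and T: "well_ordered T"
  shows "finite {a \<in> S. e - a \<in> T}"
proof (rule ccontr)
  assume "infinite {a \<in> S. e - a \<in> T}"
  then obtain s :: "nat \<Rightarrow> real" where s: "inj s" "range s \<subseteq> {a \<in> S. e - a \<in> T}"
    using infinite_iff_countable_subset[of "{a \<in> S. e - a \<in> T}"] by auto
  obtain g :: "nat \<Rightarrow> nat" where g: "strict_mono g" "monoseq (\<lambda>n. s (g n))"
    using seq_monosub[of s] by auto
  have ne: "s (g (Suc n)) \<noteq> s (g n)" for n
    using strict_monoD[OF g(1), of n "Suc n"] inj_eq[OF s(1)] by simp
  have mem: "s k \<in> S" "e - s k \<in> T" for k using s(2) by auto
  from g(2) show False unfolding monoseq_Suc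
  proof
    assume i: "\<forall>n. s (g n) \<le> s (g (Suc n))"
    then have "s (g n) < s (g (Suc n))" for n using ne[of n] by (simp add: less_le)
    then show False using mem by (intro well_ordered_no_descent[OF T, of "\<lambda>n. e - s (g n)"]) auto
  next
    assume i: "\<forall>n. s (g (Suc n)) \<le> s (g n)"
    then have "s (g (Suc n)) < s (g n)" for n using ne[of n] by (simp add: less_le)
    then show False using mem by (intro well_ordered_no_descent[OF S, of "\<lambda>n. s (g n)"]) auto
  qed
qed

section \<open>The field of Hahn series with real exponents and complex coefficients\<close>

typedef hahn = "{f :: real \<Rightarrow> complex. well_ordered {e. f e \<noteq> 0}}"
  morphisms hahn_coeff Abs_hahn
  by (rule exI[of _ "\<lambda>_. 0"]) (simp add: wfp_on_iff_ex_minimal)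

definition hahn_supp :: "hahn \<Rightarrow> real set" where
  "hahn_supp x = {e. hahn_coeff x e \<noteq> 0}"

lemma hahn_eqI: "(\<And>e. hahn_coeff x e = hahn_coeff y e) \<Longrightarrow> x = y"
  by (simp add: hahn_coeff_inject[symmetric] fun_eq_iff)

lemma well_ordered_supp: "well_ordered (hahn_supp x)"
  using hahn_coeff[of x] by (simp add: hahn_supp_def)

lemma hahn_coeff_Abs: "well_ordered S \<Longrightarrow> {e. f e \<noteq> 0} \<subseteq> S \<Longrightarrow> hahn_coeff (Abs_hahn f) = f"
  by (rule Abs_hahn_inverse) (simp add: well_ordered_subset)

lemma hahn_coeff_notin: "e \<notin> hahn_supp x \<Longrightarrow> hahn_coeff x e = 0"
  by (simp add: hahn_supp_def)

text \<open>\<^term>\<open>hahn_monom c d\<close> is the series \<open>c t\<^sup>d\<close>.\<close>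

definition hahn_monom :: "complex \<Rightarrow> real \<Rightarrow> hahn" where
  "hahn_monom c d = Abs_hahn (\<lambda>e. if e = d then c else 0)"

lemma hahn_coeff_monom: "hahn_coeff (hahn_monom c d) e = (if e = d then c else 0)"
  unfolding hahn_monom_def
  by (subst hahn_coeff_Abs[of "{d}"]) (auto intro: well_ordered_finite)

text \<open>The Cauchy product; the index set is finite by \<open>finite_mult_index\<close>.\<close>

instantiation hahn :: comm_ring_1
begin

definition "0 = Abs_hahn (\<lambda>_. 0)"
definition "1 = hahn_monom 1 0"
definition "x + y = Abs_hahn (\<lambda>e. hahn_coeff x e + hahn_coeff y e)"
definition "- x = Abs_hahn (\<lambda>e. - hahn_coeff x e)"
definition "x - y = Abs_hahn (\<lambda>e. hahn_coeff x e - hahn_coeff y e)"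
definition "x * y = Abs_hahn (\<lambda>e. \<Sum>a | a \<in> hahn_supp x \<and> e - a \<in> hahn_supp y.
    hahn_coeff x a * hahn_coeff y (e - a))"

lemma hahn_coeff_0: "hahn_coeff 0 e = 0"
  unfolding zero_hahn_def by (subst hahn_coeff_Abs[of "{}"]) (auto intro: well_ordered_finite)

lemma hahn_coeff_1: "hahn_coeff 1 e = (if e = 0 then 1 else 0)"
  unfolding one_hahn_def by (rule hahn_coeff_monom)

lemma hahn_coeff_add: "hahn_coeff (x + y) e = hahn_coeff x e + hahn_coeff y e"
  unfolding plus_hahn_def
  by (subst hahn_coeff_Abs[OF well_ordered_Un[OF well_ordered_supp[of x] well_ordered_supp[of y]]])
     (auto simp: hahn_supp_def)

lemma hahn_coeff_minus: "hahn_coeff (- x) e = - hahn_coeff x e"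
  unfolding uminus_hahn_def
  by (subst hahn_coeff_Abs[OF well_ordered_supp[of x]]) (auto simp: hahn_supp_def)

lemma hahn_coeff_diff: "hahn_coeff (x - y) e = hahn_coeff x e - hahn_coeff y e"
  unfolding minus_hahn_def
  by (subst hahn_coeff_Abs[OF well_ordered_Un[OF well_ordered_supp[of x] well_ordered_supp[of y]]])
     (auto simp: hahn_supp_def)

lemma hahn_coeff_mult: "hahn_coeff (x * y) e = (\<Sum>a | a \<in> hahn_supp x \<and> e - a \<in> hahn_supp y.
    hahn_coeff x a * hahn_coeff y (e - a))"
proof -
  have "{e. (\<Sum>a | a \<in> hahn_supp x \<and> e - a \<in> hahn_supp y. hahn_coeff x a * hahn_coeff y (e - a)) \<noteq> 0}
      \<subseteq> {a + b |a b. a \<in> hahn_supp x \<and> b \<in> hahn_supp y}"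
  proof (intro subsetI, elim CollectE)
    fix e
    assume "(\<Sum>a | a \<in> hahn_supp x \<and> e - a \<in> hahn_supp y. hahn_coeff x a * hahn_coeff y (e - a)) \<noteq> 0"
    then obtain a where "a \<in> hahn_supp x" "e - a \<in> hahn_supp y"
      by (metis (no_types, lifting) sum.neutral mem_Collect_eq)
    then show "e \<in> {a + b |a b. a \<in> hahn_supp x \<and> b \<in> hahn_supp y}"
      by (intro CollectI exI[of _ a] exI[of _ "e - a"]) auto
  qed
  from hahn_coeff_Abs[OF well_ordered_sums[OF well_ordered_supp well_ordered_supp] this]
  show ?thesis unfolding times_hahn_def by simp
qed

lemma finite_mult_index: "finite {a. a \<in> hahn_supp x \<and> e - a \<in> hahn_supp y}"
  using finite_decompositions[OF well_ordered_supp well_ordered_supp] by simp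

lemma hahn_coeff_mult':
  assumes "finite A" "{a. a \<in> hahn_supp x \<and> e - a \<in> hahn_supp y} \<subseteq> A"
  shows "hahn_coeff (x * y) e = (\<Sum>a\<in>A. hahn_coeff x a * hahn_coeff y (e - a))"
  unfolding hahn_coeff_mult using assms
  by (intro sum.mono_neutral_left) (auto simp: hahn_supp_def)

lemma hahn_supp_add: "hahn_supp (x + y) \<subseteq> hahn_supp x \<union> hahn_supp y"
  by (auto simp: hahn_supp_def hahn_coeff_add)

lemma hahn_supp_mult: "hahn_supp (x * y) \<subseteq> {a + b |a b. a \<in> hahn_supp x \<and> b \<in> hahn_supp y}"
proof
  fix e assume "e \<in> hahn_supp (x * y)"
  then have "hahn_coeff (x * y) e \<noteq> 0" by (simp add: hahn_supp_def)
  then obtain a where "a \<in> hahn_supp x" "e - a \<in> hahn_supp y"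
    unfolding hahn_coeff_mult by (metis (no_types, lifting) sum.neutral mem_Collect_eq)
  then show "e \<in> {a + b |a b. a \<in> hahn_supp x \<and> b \<in> hahn_supp y}"
    by (intro CollectI exI[of _ a] exI[of _ "e - a"]) auto
qed

lemma hahn_mult_comm: "(x :: hahn) * y = y * x"
proof (rule hahn_eqI)
  fix e
  show "hahn_coeff (x * y) e = hahn_coeff (y * x) e"
    unfolding hahn_coeff_mult
    by (rule sum.reindex_bij_witness[of _ "\<lambda>a. e - a" "\<lambda>a. e - a"]) auto
qed

lemma hahn_mult_distrib: "((x :: hahn) + y) * z = x * z + y * z"
proof (rule hahn_eqI)
  fix e
  let ?A = "{a. a \<in> hahn_supp x \<and> e - a \<in> hahn_supp z} \<union> {a. a \<in> hahn_supp y \<and> e - a \<in> hahn_supp z}"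
  have fin: "finite ?A" by (simp add: finite_mult_index)
  have "hahn_coeff ((x + y) * z) e = (\<Sum>a\<in>?A. hahn_coeff (x + y) a * hahn_coeff z (e - a))"
    using hahn_supp_add[of x y] by (intro hahn_coeff_mult' fin) auto
  also have "\<dots> = (\<Sum>a\<in>?A. hahn_coeff x a * hahn_coeff z (e - a)) + (\<Sum>a\<in>?A. hahn_coeff y a * hahn_coeff z (e - a))"
    by (simp add: hahn_coeff_add distrib_right sum.distrib)
  also have "(\<Sum>a\<in>?A. hahn_coeff x a * hahn_coeff z (e - a)) = hahn_coeff (x * z) e"
    by (rule hahn_coeff_mult'[symmetric, OF fin]) auto
  also have "(\<Sum>a\<in>?A. hahn_coeff y a * hahn_coeff z (e - a)) = hahn_coeff (y * z) e"
    by (rule hahn_coeff_mult'[symmetric, OF fin]) auto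
  finally show "hahn_coeff ((x + y) * z) e = hahn_coeff (x * z + y * z) e"
    by (simp add: hahn_coeff_add)
qed

lemma hahn_mult_assoc': "((x :: hahn) * y) * z = x * (y * z)"
proof (rule hahn_eqI)
  fix e
  let ?X = "hahn_supp x" and ?Y = "hahn_supp y" and ?Z = "hahn_supp z"
  let ?XY = "{a + b |a b. a \<in> ?X \<and> b \<in> ?Y}" and ?YZ = "{a + b |a b. a \<in> ?Y \<and> b \<in> ?Z}"
  let ?C = "{c \<in> ?XY. e - c \<in> ?Z}" and ?A = "{a \<in> ?X. e - a \<in> ?YZ}"
  let ?D = "\<lambda>c. {a. a \<in> ?X \<and> c - a \<in> ?Y}" and ?B = "\<lambda>a. {b. b \<in> ?Y \<and> (e - a) - b \<in> ?Z}"
  have finC: "finite ?C"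
    by (intro finite_decompositions well_ordered_sums well_ordered_supp)
  have finA: "finite ?A"
    by (intro finite_decompositions well_ordered_sums well_ordered_supp)
  have "hahn_coeff ((x * y) * z) e = (\<Sum>c\<in>?C. hahn_coeff (x * y) c * hahn_coeff z (e - c))"
    using hahn_supp_mult[of x y] by (intro hahn_coeff_mult'[OF finC]) blast
  also have "\<dots> = (\<Sum>c\<in>?C. \<Sum>a\<in>?D c. hahn_coeff x a * hahn_coeff y (c - a) * hahn_coeff z (e - c))"
    by (simp add: hahn_coeff_mult sum_distrib_right)
  also have "\<dots> = (\<Sum>(c,a)\<in>Sigma ?C ?D. hahn_coeff x a * hahn_coeff y (c - a) * hahn_coeff z (e - c))"
    by (intro sum.Sigma finC ballI finite_mult_index)
  also have "\<dots> = (\<Sum>(a,b)\<in>Sigma ?A ?B. hahn_coeff x a * hahn_coeff y b * hahn_coeff z (e - a - b))"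
  proof (rule sum.reindex_bij_witness[of _ "\<lambda>(a,b). (a + b, a)" "\<lambda>(c,a). (a, c - a)"], goal_cases)
    case (2 p)
    then obtain c a where p: "p = (c, a)" "e - c \<in> ?Z" "a \<in> ?X" "c - a \<in> ?Y" by auto
    have "e - a = (c - a) + (e - c)" by simp
    with p have "e - a \<in> ?YZ" by blast
    with p show ?case by simp
  next
    case (4 p)
    then obtain a b where p: "p = (a, b)" "a \<in> ?X" "b \<in> ?Y" "e - a - b \<in> ?Z" by auto
    then have "a + b \<in> ?XY" by blast
    with p show ?case by (simp add: diff_diff_eq)
  qed (auto simp: algebra_simps)
  also have "\<dots> = (\<Sum>a\<in>?A. \<Sum>b\<in>?B a. hahn_coeff x a * hahn_coeff y b * hahn_coeff z (e - a - b))"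
    by (intro sum.Sigma[symmetric] finA ballI finite_mult_index)
  also have "\<dots> = (\<Sum>a\<in>?A. hahn_coeff x a * hahn_coeff (y * z) (e - a))"
    by (simp add: hahn_coeff_mult sum_distrib_left mult.assoc)
  also have "\<dots> = hahn_coeff (x * (y * z)) e"
    using hahn_supp_mult[of y z] by (intro hahn_coeff_mult'[OF finA, symmetric]) blast
  finally show "hahn_coeff ((x * y) * z) e = hahn_coeff (x * (y * z)) e" .
qed

lemma hahn_coeff_monom_mult: "hahn_coeff (hahn_monom c d * x) e = c * hahn_coeff x (e - d)"
  by (subst hahn_coeff_mult'[of "{d}"]) (auto simp: hahn_coeff_monom hahn_supp_def split: if_splits)

instance
proof
  fix a b c :: hahn
  show "1 * a = a"
    by (rule hahn_eqI) (simp add: one_hahn_def hahn_coeff_monom_mult)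
  show "(0::hahn) \<noteq> 1"
    using hahn_coeff_0[of 0] hahn_coeff_1[of 0] by auto
qed (rule hahn_mult_assoc' hahn_mult_comm hahn_mult_distrib
  | rule hahn_eqI, simp add: hahn_coeff_0 hahn_coeff_add hahn_coeff_minus hahn_coeff_diff)+

end

lemma hahn_coeff_mult_cong:
  assumes "\<And>a. a \<in> hahn_supp v \<Longrightarrow> a \<ge> 0" "\<And>a. a \<le> e \<Longrightarrow> hahn_coeff y a = hahn_coeff z a"
  shows "hahn_coeff (v * y) e = hahn_coeff (v * z) e"
  unfolding hahn_coeff_mult by (rule sum.cong) (use assms in \<open>auto simp: hahn_supp_def\<close>)

lemma hahn_supp_power_bound:
  assumes "\<And>a. a \<in> hahn_supp u \<Longrightarrow> s \<le> a" "a \<in> hahn_supp (u ^ n)"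
  shows "real n * s \<le> a"
  using assms(2)
proof (induction n arbitrary: a)
  case 0
  then show ?case by (auto simp: hahn_supp_def hahn_coeff_1 split: if_splits)
next
  case (Suc n)
  from Suc.prems hahn_supp_mult[of u "u ^ n"] obtain b c
    where "a = b + c" "b \<in> hahn_supp u" "c \<in> hahn_supp (u ^ n)" by auto
  with Suc.IH[of c] assms(1)[of b] show ?case by (simp add: algebra_simps)
qed

text \<open>The geometric series: each coefficient of \<open>\<Sum>n. u ^ n\<close> is a finite sum.\<close>

lemma hahn_one_minus_invertible:
  assumes s: "s > 0" "\<And>a. a \<in> hahn_supp u \<Longrightarrow> s \<le> a"
  shows "\<exists>y. (1 - u) * y = 1"
proof -
  define P where "P N = (\<Sum>n<N. u ^ n)" for N :: nat
  define N where "N e = Suc (nat \<lfloor>e / s\<rfloor>)" for e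
  have big: "e < real n * s" if "n \<ge> N e" for n e
  proof -
    have "e / s < real (N e)" unfolding N_def by linarith
    also have "\<dots> \<le> real n" using that by simp
    finally show ?thesis using s(1) by (simp add: field_simps)
  qed
  have pow0: "hahn_coeff (u ^ n) e = 0" if "n \<ge> N e" for n e
    using hahn_supp_power_bound[of u s e n] s(2) big[OF that] by (force simp: hahn_supp_def)
  have P_const: "hahn_coeff (P n) e = hahn_coeff (P (N e)) e" if "n \<ge> N e" for n e
    using that
  proof (induction n rule: dec_induct)
    case (step n)
    then show ?case by (simp add: P_def hahn_coeff_add pow0)
  qed simp
  have N_mono: "N e \<le> N e'" if "e \<le> e'" for e e'
    unfolding N_def using that s(1) by (simp add: nat_mono floor_mono divide_right_mono)
  define f where "f e = hahn_coeff (P (N e)) e" for e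
  have f: "f e = hahn_coeff (P (N e')) e" if "e \<le> e'" for e e'
    unfolding f_def using P_const[OF N_mono[OF that]] by simp
  have "well_ordered {e. f e \<noteq> 0}"
    unfolding wfp_on_iff_ex_minimal
  proof (intro allI impI)
    fix B assume B: "B \<subseteq> {e. f e \<noteq> 0}" "B \<noteq> {}"
    then obtain b where b: "b \<in> B" by auto
    have "{e \<in> B. e \<le> b} \<subseteq> hahn_supp (P (N b))"
      using B(1) f by (auto simp: hahn_supp_def)
    then obtain z where z: "z \<in> B" "z \<le> b" "\<And>y. y \<in> B \<Longrightarrow> y \<le> b \<Longrightarrow> z \<le> y"
      using b well_ordered_least[OF well_ordered_supp, of "{e \<in> B. e \<le> b}"] by blast
    show "\<exists>z\<in>B. \<forall>y. y < z \<longrightarrow> y \<notin> B"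
      using z by (meson less_le_not_le order_trans)
  qed
  then have coeff_y: "hahn_coeff (Abs_hahn f) = f" by (rule hahn_coeff_Abs) simp
  have "(1 - u) * Abs_hahn f = 1"
  proof (rule hahn_eqI)
    fix e
    have "hahn_coeff ((1 - u) * Abs_hahn f) e = hahn_coeff ((1 - u) * P (N e)) e"
    proof (rule hahn_coeff_mult_cong)
      fix a assume "a \<in> hahn_supp (1 - u)"
      then have "a = 0 \<or> a \<in> hahn_supp u" by (auto simp: hahn_supp_def hahn_coeff_diff hahn_coeff_1 split: if_splits)
      then show "a \<ge> 0" using s by force
    qed (simp add: coeff_y f)
    also have "(1 - u) * P (N e) = 1 - u ^ N e"
      by (simp add: P_def one_diff_power_eq)
    finally show "hahn_coeff ((1 - u) * Abs_hahn f) e = hahn_coeff 1 e"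
      by (simp add: hahn_coeff_diff pow0)
  qed
  then show ?thesis by blast
qed

lemma hahn_invertible:
  assumes "x \<noteq> (0 :: hahn)"
  shows "\<exists>y. x * y = 1"
proof -
  have "hahn_supp x \<noteq> {}"
    using assms hahn_eqI[of x 0] by (auto simp: hahn_supp_def hahn_coeff_0)
  then obtain d where d: "d \<in> hahn_supp x" "\<And>a. a \<in> hahn_supp x \<Longrightarrow> d \<le> a"
    using well_ordered_least[OF well_ordered_supp[of x] subset_refl] by blast
  define c where "c = hahn_coeff x d"
  have c: "c \<noteq> 0" using d(1) by (simp add: c_def hahn_supp_def)
  define m where "m = hahn_monom (1 / c) (- d)"
  define u where "u = 1 - m * x"
  have coeff_u: "hahn_coeff u e = (if e = 0 then 0 else - hahn_coeff x (e + d) / c)" for e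
    using c by (simp add: u_def m_def hahn_coeff_diff hahn_coeff_1 hahn_coeff_monom_mult c_def)
  have pos: "a > 0" if "a \<in> hahn_supp u" for a
  proof -
    have "a \<noteq> 0" "a + d \<in> hahn_supp x"
      using that by (auto simp: hahn_supp_def coeff_u split: if_splits)
    with d(2)[of "a + d"] show ?thesis by simp
  qed
  have "\<exists>s>0. \<forall>a\<in>hahn_supp u. s \<le> a"
  proof (cases "hahn_supp u = {}")
    case True
    then show ?thesis by (auto intro: exI[of _ 1])
  next
    case False
    then obtain s where "s \<in> hahn_supp u" "\<And>a. a \<in> hahn_supp u \<Longrightarrow> s \<le> a"
      using well_ordered_least[OF well_ordered_supp[of u] subset_refl] by blast
    then show ?thesis using pos by blast
  qed
  then obtain y where "(1 - u) * y = 1" using hahn_one_minus_invertible[of _ u] by blast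
  then have "x * (m * y) = 1" by (simp add: u_def ac_simps)
  then show ?thesis by blast
qed

instantiation hahn :: field
begin

definition inverse_hahn :: "hahn \<Rightarrow> hahn" where
  "inverse_hahn x = (if x = 0 then 0 else SOME y. x * y = 1)"

definition divide_hahn :: "hahn \<Rightarrow> hahn \<Rightarrow> hahn" where
  "divide_hahn x y = x * inverse y"

instance
proof
  fix a b :: hahn
  show "a \<noteq> 0 \<Longrightarrow> inverse a * a = 1"
    using someI_ex[OF hahn_invertible[of a]] by (simp add: inverse_hahn_def mult.commute)
qed (simp_all add: divide_hahn_def inverse_hahn_def)

end

definition hahn_deg :: "hahn \<Rightarrow> ereal" where
  "hahn_deg x = (if x = 0 then \<infinity> else ereal (LEAST e. e \<in> hahn_supp x))"

section \<open>Tropical rank, Kapranov rank and pattern of a real matrix\<close>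

text \<open>Rows and columns are numbered from \<open>0\<close>, as usual for the type \<^typ>\<open>'a mat\<close>.\<close>

definition tropically_nonsingular :: "real mat \<Rightarrow> bool" where
  "tropically_nonsingular S \<longleftrightarrow>
    (\<exists>!\<sigma>. \<sigma> permutes {..<dim_row S} \<and>
      (\<forall>\<tau>. \<tau> permutes {..<dim_row S} \<longrightarrow>
        (\<Sum>i<dim_row S. S $$ (i, \<sigma> i)) \<le> (\<Sum>i<dim_row S. S $$ (i, \<tau> i))))"

definition tropical_rank :: "real mat \<Rightarrow> nat" where
  "tropical_rank A = (GREATEST r. \<exists>I J. I \<subseteq> {..<dim_row A} \<and> J \<subseteq> {..<dim_col A} \<and>
      card I = r \<and> card J = r \<and> tropically_nonsingular (submatrix A I J))"

text \<open>The first argument of \<^const>\<open>vec_space.rank\<close> is the number of rows, i.e. the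
  dimension of the space containing the columns.\<close>

definition kapranov_rank :: "real mat \<Rightarrow> nat" where
  "kapranov_rank B = (LEAST r. \<exists>A :: hahn mat. A \<in> carrier_mat (dim_row B) (dim_col B) \<and>
      (\<forall>i<dim_row B. \<forall>j<dim_col B. hahn_deg (A $$ (i, j)) = ereal (B $$ (i, j))) \<and>
      vec_space.rank (dim_row B) A = r)"

definition pattern :: "real mat \<Rightarrow> ereal mat" where
  "pattern A = mat (dim_row A) (dim_col A)
    (\<lambda>(u, v). if A $$ (u, v) = Min {A $$ (i, v) |i. i < dim_row A} then 0 else \<infinity>)"

definition col_support :: "ereal mat \<Rightarrow> nat \<Rightarrow> nat set" where
  "col_support P v = {u. u < dim_row P \<and> P $$ (u, v) = 0}"

end

(* A lift of rank 3 is written down directly.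
   Scale the columns so that their minima are 0. Take a 3-dimensional space spanned by
   (1,1,1,e4,e5,e6), (d1,d2,d3,1,1,1) and (0,1,2,0,1,2), where the d's and e's are monomials of
   positive degree chosen so that the first two vectors lift the two special columns. Any other
   column is positive at no more than one position i <= 3 and one position j >= 4; prescribing
   the coordinates i and j of a vector of the space is a linear system of determinant
   1 - d_i e_j, a unit, and since 0, 1, 2 are distinct, the remaining coordinates
   of the solution have degree 0. *)

theory Submission
  imports Defs
begin

text \<open>Each summand is an outer product of rank at most 1, and rank is subadditive.\<close>

lemma (in vec_space) rank_le_sum_products:
  fixes f g :: "nat \<Rightarrow> nat \<Rightarrow> 'a"
  shows "rank (mat n nc (\<lambda>(i, j). \<Sum>k<r. f k i * g k j)) \<le> r"
proof (induction r)
  case 0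
  have "mat n nc (\<lambda>(i, j). \<Sum>k<0. f k i * g k j) = 0\<^sub>m n nc" by (rule eq_matI) auto
  then show ?case by (simp only: rank_0I le_refl)
next
  case (Suc r)
  let ?A = "mat n nc (\<lambda>(i, j). \<Sum>k<r. f k i * g k j)" and ?B = "mat n nc (\<lambda>(i, j). f r i * g r j)"
  have "mat n nc (\<lambda>(i, j). \<Sum>k<Suc r. f k i * g k j) = ?A + ?B" by (rule eq_matI) auto
  moreover have "rank (?A + ?B) \<le> rank ?A + rank ?B" by (rule rank_subadditive) auto
  moreover have "rank ?B \<le> 1" by (rule rank_le_1_product_entries[of _ _ "f r" "g r"]) auto
  ultimately show ?case using Suc.IH by (simp only:)
qed

text \<open>The vectors \<open>f k\<close> span the columns of a lift, and \<open>g k j\<close> are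
  the coefficients of column \<open>j\<close>. With \<open>f\<close> fixed, the columns can be
  lifted one at a time.\<close>

lemma kapranov_rank_le:
  fixes f g :: "nat \<Rightarrow> nat \<Rightarrow> hahn"
  assumes "\<And>i j. i < dim_row B \<Longrightarrow> j < dim_col B \<Longrightarrow>
    hahn_deg (\<Sum>k<r. f k i * g k j) = ereal (B $$ (i, j))"
  shows "kapranov_rank B \<le> r"
proof -
  let ?A = "mat (dim_row B) (dim_col B) (\<lambda>(i, j). \<Sum>k<r. f k i * g k j)"
  have "kapranov_rank B \<le> vec_space.rank (dim_row B) ?A"
    unfolding kapranov_rank_def by (rule Least_le, rule exI[of _ ?A]) (simp add: assms)
  also have "\<dots> \<le> r" by (rule vec_space.rank_le_sum_products)
  finally show ?thesis .
qed

text \<open>The series is \<open>c t\<^sup>r\<close> plus terms of higher order; \<open>c = 0\<close> is allowed.\<close>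

definition hahn_lead :: "hahn \<Rightarrow> real \<Rightarrow> complex \<Rightarrow> bool" where
  "hahn_lead x r c \<longleftrightarrow> hahn_coeff x r = c \<and> (\<forall>e<r. hahn_coeff x e = 0)"

lemma hahn_deg_lead:
  assumes "hahn_lead x r c" "c \<noteq> 0"
  shows "hahn_deg x = ereal r"
proof -
  have "x \<noteq> 0" using assms by (auto simp: hahn_lead_def hahn_coeff_0)
  moreover have "(LEAST e. e \<in> hahn_supp x) = r"
    using assms by (intro Least_equality) (auto simp: hahn_lead_def hahn_supp_def not_less[symmetric])
  ultimately show ?thesis by (simp add: hahn_deg_def)
qed

lemma hahn_lead_add: "hahn_lead x r c \<Longrightarrow> hahn_lead y r d \<Longrightarrow> hahn_lead (x + y) r (c + d)"
  by (simp add: hahn_lead_def hahn_coeff_add)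

lemma hahn_lead_diff: "hahn_lead x r c \<Longrightarrow> hahn_lead y r d \<Longrightarrow> hahn_lead (x - y) r (c - d)"
  by (simp add: hahn_lead_def hahn_coeff_diff)

lemma hahn_lead_mult:
  assumes x: "hahn_lead x r c" and y: "hahn_lead y s d"
  shows "hahn_lead (x * y) (r + s) (c * d)"
proof -
  have supp: "r \<le> a" "s \<le> e - a" if "a \<in> hahn_supp x" "e - a \<in> hahn_supp y" for a e
    using that x y by (auto simp: hahn_lead_def hahn_supp_def not_less[symmetric])
  have "hahn_coeff (x * y) e = 0" if "e < r + s" for e
  proof -
    have "{a. a \<in> hahn_supp x \<and> e - a \<in> hahn_supp y} = {}"
      using supp[of _ e] that by fastforce
    then show ?thesis by (simp only: hahn_coeff_mult sum.empty)
  qed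
  \<comment> \<open>The index set may be empty, since \<open>c\<close> or \<open>d\<close> may be 0;
    it is enough that \<open>{r}\<close> contains it.\<close>
  moreover have "hahn_coeff (x * y) (r + s) = (\<Sum>a\<in>{r}. hahn_coeff x a * hahn_coeff y (r + s - a))"
    using supp[of _ "r + s"] by (intro hahn_coeff_mult') fastforce+
  ultimately show ?thesis using x y by (simp add: hahn_lead_def)
qed

lemma hahn_lead_mult_0: "hahn_lead x 0 c \<Longrightarrow> hahn_lead y 0 d \<Longrightarrow> hahn_lead (x * y) 0 (c * d)"
  using hahn_lead_mult[of x 0 c y 0 d] by simp

lemma hahn_lead_monom: "hahn_lead (hahn_monom c r) r c"
  by (simp add: hahn_lead_def hahn_coeff_monom)

text \<open>Gives the constant term of a prescribed coordinate without knowing whether its degree is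
  0 or positive.\<close>

lemma hahn_lead_monom_0: "r \<ge> 0 \<Longrightarrow> hahn_lead (hahn_monom c r) 0 (if r = 0 then c else 0)"
  by (auto simp: hahn_lead_def hahn_coeff_monom)

lemma hahn_lead_1: "hahn_lead 1 0 1"
  by (simp add: one_hahn_def hahn_lead_monom)

text \<open>Half of a generic column. The coefficients \<open>X - a - \<delta> w\<close>, \<open>w - \<epsilon> (X - a)\<close>, \<open>1 - \<delta> \<epsilon>\<close> solve
  the linear system that prescribes one coordinate of either half, multiplied by its
  determinant.\<close>

lemma hahn_deg_solved_coordinate:
  assumes x: "x \<ge> 0" and \<delta>: "hahn_lead \<delta> 0 0" and \<epsilon>: "hahn_lead \<epsilon> 0 0" and w: "hahn_lead w 0 b"
    and \<delta>': "\<delta>' = (if k = i then \<delta> else \<delta>'')" "hahn_lead \<delta>'' 0 0"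
    and ki: "k < 3" "i < 3"
    and u: "u = hahn_monom 10 x - hahn_monom (of_nat i) 0"
  shows "hahn_deg (u - \<delta> * w + (w - \<epsilon> * u) * \<delta>' + (1 - \<delta> * \<epsilon>) * hahn_monom (of_nat k) 0)
    = ereal (if k = i then x else 0)"
proof (cases "k = i")
  case True
  have "hahn_lead ((1 - \<delta> * \<epsilon>) * hahn_monom 10 x) (0 + x) ((1 - 0 * 0) * 10)"
    by (intro hahn_lead_mult hahn_lead_diff hahn_lead_1 hahn_lead_mult_0 \<delta> \<epsilon> hahn_lead_monom)
  \<comment> \<open>At the prescribed coordinate the solution is the determinant times
    \<open>hahn_monom 10 x\<close>, and the determinant has leading term 1.\<close>
  moreover have "u - \<delta> * w + (w - \<epsilon> * u) * \<delta> + (1 - \<delta> * \<epsilon>) * hahn_monom (of_nat i) 0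
      = (1 - \<delta> * \<epsilon>) * hahn_monom 10 x"
    by (simp add: u algebra_simps)
  ultimately show ?thesis using True \<delta>'(1) by (simp add: hahn_deg_lead)
next
  case False
  \<comment> \<open>The constant term of \<open>hahn_monom 10 x\<close>. The coefficient 10 keeps
    \<open>10 - i + k\<close> nonzero for all \<open>i\<close>, \<open>k\<close> below 3.\<close>
  define c :: complex where "c = (if x = 0 then 10 else 0)"
  have u0: "hahn_lead u 0 (c - of_nat i)"
    unfolding u c_def using x by (intro hahn_lead_diff hahn_lead_monom_0 hahn_lead_monom)
  have "hahn_lead (u - \<delta> * w + (w - \<epsilon> * u) * \<delta>'' + (1 - \<delta> * \<epsilon>) * hahn_monom (of_nat k) 0) 0
      (c - of_nat i - 0 * b + (b - 0 * (c - of_nat i)) * 0 + (1 - 0 * 0) * of_nat k)"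
    by (intro hahn_lead_add hahn_lead_mult_0 hahn_lead_diff hahn_lead_1 \<delta> \<epsilon> \<delta>'(2) u0 w hahn_lead_monom)
  \<comment> \<open>All terms containing \<delta>, \<epsilon> or \<delta>'' have constant term 0.
    What remains is \<open>k - i\<close> if \<open>x > 0\<close> and \<open>10 - i + k\<close> if
    \<open>x = 0\<close>.\<close>
  moreover have "c - of_nat i + of_nat k \<noteq> 0"
    using ki False by (auto simp: c_def numeral_3_eq_3 less_Suc_eq)
  ultimately show ?thesis using False \<delta>'(1) by (simp add: hahn_deg_lead)
qed

text \<open>Undoes the normalisation of a column: scaling by a monomial shifts every degree by the
  column minimum.\<close>

lemma hahn_deg_monom_mult:
  assumes "hahn_deg z = ereal r"
  shows "hahn_deg (hahn_monom 1 m * z) = ereal (m + r)"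
proof -
  have z: "z \<noteq> 0" "(LEAST e. e \<in> hahn_supp z) = r"
    using assms by (auto simp: hahn_deg_def split: if_splits)
  have "hahn_supp z \<noteq> {}"
    using z(1) hahn_eqI[of z 0] by (auto simp: hahn_supp_def hahn_coeff_0)
  then obtain d where d: "d \<in> hahn_supp z" "\<And>a. a \<in> hahn_supp z \<Longrightarrow> d \<le> a"
    using well_ordered_least[OF well_ordered_supp[of z] subset_refl] by blast
  then have "d = r" using z(2) by (metis (no_types, lifting) Least_equality)
  then have "hahn_lead z r (hahn_coeff z r)" "hahn_coeff z r \<noteq> 0"
    using d by (auto simp: hahn_lead_def hahn_supp_def not_less[symmetric])
  then show ?thesis
    using hahn_lead_mult[OF hahn_lead_monom] hahn_deg_lead by (metis mult_1)
qed

text \<open>If no choice of \<open>i\<close> worked, at most one of the three would lie in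
  \<open>S\<close>. This finds the only position in a half where a generic column can be
  positive.\<close>

lemma omit_one_of_three:
  assumes "card (S \<inter> {a, b, c :: nat}) \<ge> 2"
  shows "\<exists>i\<in>{a, b, c}. {a, b, c} - {i} \<subseteq> S"
proof (rule ccontr)
  assume neg: "\<not> ?thesis"
  have "card (S \<inter> {a, b, c}) \<le> 1"
    using neg by (cases "a \<in> S"; cases "b \<in> S"; cases "c \<in> S") (auto simp: card_insert_if)
  with assms show False by simp
qed

theorem theorem3p6:
  fixes n :: nat
  shows "\<not> (\<exists>W :: real mat. W \<in> carrier_mat 6 n \<and>
    tropical_rank W = 3 \<and>
    kapranov_rank W > 3 \<and>
    (\<forall>u<6. \<exists>v<n. pattern W $$ (u, v) = 0) \<and>
    (\<exists>v1<n. \<exists>v2<n.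
      col_support (pattern W) v1 = {0, 1, 2} \<and>
      col_support (pattern W) v2 = {3, 4, 5} \<and>
      (\<forall>v<n. v \<noteq> v1 \<and> v \<noteq> v2 \<longrightarrow>
        card (col_support (pattern W) v \<inter> {0, 1, 2}) \<ge> 2 \<and>
        card (col_support (pattern W) v \<inter> {3, 4, 5}) \<ge> 2)))"
proof clarify
  fix W :: "real mat" and v1 v2
  assume W: "W \<in> carrier_mat 6 n" and rk: "kapranov_rank W > 3"
    and v12: "v1 < n" "v2 < n"
    and s1: "col_support (pattern W) v1 = {0, 1, 2}"
    and s2: "col_support (pattern W) v2 = {3, 4, 5}"
    and gen: "\<forall>v<n. v \<noteq> v1 \<and> v \<noteq> v2 \<longrightarrow>
        card (col_support (pattern W) v \<inter> {0, 1, 2}) \<ge> 2 \<and>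
        card (col_support (pattern W) v \<inter> {3, 4, 5}) \<ge> 2"
  define m where "m v = Min {W $$ (i, v) |i. i < 6}" for v
  have m_le: "m v \<le> W $$ (i, v)" if "i < 6" for i v
    unfolding m_def by (rule Min_le) (use that in auto)
  have supp: "i \<in> col_support (pattern W) v \<longleftrightarrow> i < 6 \<and> W $$ (i, v) = m v" if "v < n" for i v
    using W that by (auto simp: col_support_def pattern_def m_def split: if_splits)
  \<comment> \<open>The positive entries of the two normalised special columns: rows 0 to 2 are
    taken from \<open>v2\<close>, rows 3 to 5 from \<open>v1\<close>. They are the exponents of the
    d's and e's.\<close>
  define p where "p i = W $$ (i, if i < 3 then v2 else v1) - m (if i < 3 then v2 else v1)" for i
  have p_pos: "p i > 0" if "i < 6" for i
    using that supp[OF v12(1), of i] supp[OF v12(2), of i] m_le[of i v1] m_le[of i v2]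
    by (auto simp: p_def s1 s2 less_le)
  have p_lead: "hahn_lead (hahn_monom 1 (p i)) 0 0" if "i < 6" for i
    using hahn_lead_monom_0[of "p i" 1] p_pos[OF that] by simp
  define f where "f k i = (if k = 0 then if i < 3 then 1 else hahn_monom 1 (p i)
    else if k = 1 then if i < 3 then hahn_monom 1 (p i) else 1
    else hahn_monom (of_nat (i mod 3)) 0)" for k i :: nat
  have ex: "\<exists>g. \<forall>i<6. hahn_deg (\<Sum>k<3. f k i * g k) = ereal (W $$ (i, v))" if v: "v < n" for v
  proof -
    \<comment> \<open>It suffices to lift the column with its minimum subtracted.\<close>
    have scale: ?thesis
      if "\<And>i. i < 6 \<Longrightarrow> hahn_deg (f 0 i * g0 + f 1 i * g1 + f 2 i * g2) = ereal (W $$ (i, v) - m v)"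
      for g0 g1 g2
    proof (intro exI[of _ "\<lambda>k. hahn_monom 1 (m v) * (if k = 0 then g0 else if k = 1 then g1 else g2)"] allI impI)
      fix i :: nat assume i: "i < 6"
      have "hahn_deg (hahn_monom 1 (m v) * (f 0 i * g0 + f 1 i * g1 + f 2 i * g2)) = ereal (W $$ (i, v))"
        using hahn_deg_monom_mult[OF that[OF i], of "m v"] by simp
      then show "hahn_deg (\<Sum>k<3. f k i * (hahn_monom 1 (m v) * (if k = 0 then g0 else if k = 1 then g1 else g2)))
          = ereal (W $$ (i, v))"
        by (simp add: numeral_3_eq_3 algebra_simps numeral_2_eq_2)
    qed
    have unit: "hahn_deg 1 = ereal 0" using hahn_deg_lead[OF hahn_lead_1] by simp
    have monom: "hahn_deg (hahn_monom 1 r) = ereal r" for r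
      using hahn_deg_lead[OF hahn_lead_monom] by simp
    consider "v = v1" | "v = v2" | "v \<noteq> v1" "v \<noteq> v2" by blast
    then show ?thesis
    proof cases
      case 1
      show ?thesis
      proof (rule scale[of 1 0 0])
        fix i :: nat assume i: "i < 6"
        show "hahn_deg (f 0 i * 1 + f 1 i * 0 + f 2 i * 0) = ereal (W $$ (i, v) - m v)"
          using supp[OF v12(1), of i] i 1 by (auto simp: f_def p_def s1 unit monom)
      qed
    next
      case 2
      show ?thesis
      proof (rule scale[of 0 1 0])
        fix i :: nat assume i: "i < 6"
        show "hahn_deg (f 0 i * 0 + f 1 i * 1 + f 2 i * 0) = ereal (W $$ (i, v) - m v)"
          using supp[OF v12(2), of i] i 2 by (auto simp: f_def p_def s2 unit monom)
      qed
    next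
      case 3
      then obtain i j where i: "i \<in> {0, 1, 2}" "{0, 1, 2} - {i} \<subseteq> col_support (pattern W) v"
        and j: "j \<in> {3, 4, 5}" "{3, 4, 5} - {j} \<subseteq> col_support (pattern W) v"
        using gen v by (meson omit_one_of_three)
      have ij: "i < 3" "j < 6" "3 \<le> j" using i j by auto
      define x where "x = W $$ (i, v) - m v"
      define y where "y = W $$ (j, v) - m v"
      have xy: "x \<ge> 0" "y \<ge> 0" using m_le[of i v] m_le[of j v] ij by (auto simp: x_def y_def)
      have top: "W $$ (k, v) - m v = (if k = i then x else 0)" if "k < 3" for k
      proof (cases "k = i")
        case False
        then have "k \<in> {0, 1, 2} - {i}" using that by auto
        then show ?thesis using supp[OF v, of k] i(2) False by auto
      qed (simp add: x_def)
      \<comment> \<open>The rows of the lower half are renumbered from 0, so that both halves fit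
        \<open>hahn_deg_solved_coordinate\<close>.\<close>
      have bot: "W $$ (k, v) - m v = (if k - 3 = j - 3 then y else 0)" if "3 \<le> k" "k < 6" for k
      proof (cases "k = j")
        case False
        then have "k \<in> {3, 4, 5} - {j}" using that by auto
        then show ?thesis using supp[OF v, of k] j(2) False that ij by auto
      qed (simp add: y_def)
      define \<delta> where "\<delta> = hahn_monom 1 (p i)"
      define \<epsilon> where "\<epsilon> = hahn_monom 1 (p j)"
      define u where "u = hahn_monom 10 x - hahn_monom (of_nat i) 0"
      define w where "w = hahn_monom 10 y - hahn_monom (of_nat (j - 3)) 0"
      have lead: "hahn_lead \<delta> 0 0" "hahn_lead \<epsilon> 0 0" using ij by (simp_all add: \<delta>_def \<epsilon>_def p_lead)
      have u0: "hahn_lead u 0 ((if x = 0 then 10 else 0) - of_nat i)"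
        unfolding u_def using xy by (intro hahn_lead_diff hahn_lead_monom_0 hahn_lead_monom)
      have w0: "hahn_lead w 0 ((if y = 0 then 10 else 0) - of_nat (j - 3))"
        unfolding w_def using xy by (intro hahn_lead_diff hahn_lead_monom_0 hahn_lead_monom)
      show ?thesis
      proof (rule scale[of "u - \<delta> * w" "w - \<epsilon> * u" "1 - \<delta> * \<epsilon>"])
        fix k :: nat assume k: "k < 6"
        show "hahn_deg (f 0 k * (u - \<delta> * w) + f 1 k * (w - \<epsilon> * u) + f 2 k * (1 - \<delta> * \<epsilon>))
            = ereal (W $$ (k, v) - m v)"
        proof (cases "k < 3")
          case True
          \<comment> \<open>This instantiates \<delta>' and \<delta>'' with the same monomial: it is
            \<delta> at row \<open>i\<close> and has constant term 0 in every row.\<close>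
          have "hahn_monom 1 (p k) = (if k = i then \<delta> else hahn_monom 1 (p k))" by (simp add: \<delta>_def)
          from hahn_deg_solved_coordinate[OF xy(1) lead w0 this p_lead[OF k] True ij(1) u_def]
          show ?thesis using True by (simp add: top f_def mult.commute)
        next
          case False
          then have k': "3 \<le> k" "k - 3 < 3" "j - 3 < 3" "k mod 3 = k - 3"
            using k ij by (auto simp: mod_if)
          have "hahn_monom 1 (p k) = (if k - 3 = j - 3 then \<epsilon> else hahn_monom 1 (p k))"
            using eq_diff_iff[of 3 k j] k'(1) ij(3) by (simp add: \<epsilon>_def)
          \<comment> \<open>In the lower half the first two spanning vectors exchange roles, hence
            so do \<delta> and \<epsilon>, and \<open>u\<close> and \<open>w\<close>; the
            determinant is symmetric.\<close>
          from hahn_deg_solved_coordinate[OF xy(2) lead(2,1) u0 this p_lead[OF k] k'(2,3) w_def]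
          show ?thesis using False bot[OF k'(1) k] k'(4) by (simp add: f_def ac_simps)
        qed
      qed
    qed
  qed
  then obtain g where "\<And>v i. v < n \<Longrightarrow> i < 6 \<Longrightarrow> hahn_deg (\<Sum>k<3. f k i * g v k) = ereal (W $$ (i, v))"
    by metis
  then have "kapranov_rank W \<le> 3"
    using W by (intro kapranov_rank_le[where f = f and g = "\<lambda>k v. g v k"]) auto
  with rk show False by simp
qed

end
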